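(* Let $G$ be a generalised dihedral group of order $2n$ and let $S$ be an inverse-closed generating set for $G$ not containing the identity. Suppose that the Cayley graph $\mathrm{Cay}(G,S)$ has diameter $2$. Then the degree $d=|S|$ of $\mathrm{Cay}(G,S)$ satisfies $d\geq 2\sqrt{n}-1$.
   Context: A generalised dihedral group is a semidirect product $H\rtimes C_2$ of an abelian group $H$ with the multiplicative group $C_2=\{\pm 1\}$, where $-1$ acts on $H$ by the inversion automorphism $h\mapsto h^{-1}$ (here $H$ is finite of order $n$). For a finite group $G$ and a subset $S\subset G$ which is inverse-closed and does not contain the identity, the Cayley graph $\mathrm{Cay}(G,S)$ is the undirected graph with vertex set $G$ and an edge between $g$ and $h$ if and only if $gh^{-1}\in S$. It is regular of degree $|S|$. *)

theory Defs
  imports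
    "HOL-Algebra.Sym_Groups"
    "HOL-Algebra.Generated_Groups"
    "Graph_Theory.Pair_Digraph"
    "Graph_Theory.Shortest_Path"
begin

definition semidirect_product ::
  "('h, 'm) monoid_scheme \<Rightarrow> ('k, 'l) monoid_scheme \<Rightarrow> ('k \<Rightarrow> 'h \<Rightarrow> 'h) \<Rightarrow> ('h \<times> 'k) monoid"
  where "semidirect_product H K \<phi> =
    \<lparr> carrier = carrier H \<times> carrier K,
      mult = (\<lambda>(h, k) (h', k'). (h \<otimes>\<^bsub>H\<^esub> \<phi> k h', k \<otimes>\<^bsub>K\<^esub> k')),
      one = (\<one>\<^bsub>H\<^esub>, \<one>\<^bsub>K\<^esub>) \<rparr>"

(* sign_img is the library's multiplicative group {-1, 1} of integers. *)
definition dihedral :: "('h, 'm) monoid_scheme \<Rightarrow> ('h \<times> int) monoid"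
  where "dihedral H =
    semidirect_product H sign_img (\<lambda>\<epsilon> h. if \<epsilon> = -1 then inv\<^bsub>H\<^esub> h else h)"

(* H is isomorphic to a subgroup of G, so letting H range over groups on the element type
   of G is no restriction: see generalised_dihedral_groupI below. *)
definition generalised_dihedral_group :: "('a, 'b) monoid_scheme \<Rightarrow> bool"
  where "generalised_dihedral_group G \<longleftrightarrow>
    group G \<and> (\<exists>H :: 'a monoid. comm_group H \<and> dihedral H \<cong> G)"

(* An undirected edge is represented by its two orientations. *)
definition cayley_graph :: "('a, 'b) monoid_scheme \<Rightarrow> 'a set \<Rightarrow> 'a pair_pre_digraph"
  where "cayley_graph G S =
    \<lparr> pverts = carrier G,
      parcs = {(g, h). g \<in> carrier G \<and> h \<in> carrier G \<and> g \<otimes>\<^bsub>G\<^esub> inv\<^bsub>G\<^esub> h \<in> S} \<rparr>"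

(* With unit weights, \<mu> is the graph distance (infinite if there is no walk). *)
definition graph_diameter :: "('v, 'e) pre_digraph \<Rightarrow> ereal"
  where "graph_diameter X =
    (SUP u\<in>verts X. SUP v\<in>verts X. wf_digraph.\<mu> X (\<lambda>_. 1) u v)"

lemma dihedral_simps [simp]:
  "carrier (dihedral H) = carrier H \<times> {-1, 1}"
  "(h, k) \<otimes>\<^bsub>dihedral H\<^esub> (h', k') = (h \<otimes>\<^bsub>H\<^esub> (if k = -1 then inv\<^bsub>H\<^esub> h' else h'), k * k')"
  "\<one>\<^bsub>dihedral H\<^esub> = (\<one>\<^bsub>H\<^esub>, 1)"
  by (auto simp: dihedral_def semidirect_product_def sign_img_def)

lemma dihedral_group:
  assumes "comm_group H"
  shows "group (dihedral H)"
proof -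
  interpret comm_group H by fact
  show ?thesis
  proof (rule groupI)
    fix x assume "x \<in> carrier (dihedral H)"
    then obtain h k where x: "x = (h, k)" "h \<in> carrier H" "k \<in> {-1, 1}" by auto
    define y where "y = (if k = -1 then h else inv\<^bsub>H\<^esub> h, k)"
    have "y \<in> carrier (dihedral H)" "y \<otimes>\<^bsub>dihedral H\<^esub> x = \<one>\<^bsub>dihedral H\<^esub>"
      using x by (auto simp: y_def)
    then show "\<exists>y\<in>carrier (dihedral H). y \<otimes>\<^bsub>dihedral H\<^esub> x = \<one>\<^bsub>dihedral H\<^esub>" by blast
  qed (auto simp: m_assoc inv_mult)
qed

lemma generalised_dihedral_groupI:
  fixes H :: "('h, 'm) monoid_scheme" and G :: "('a, 'b) monoid_scheme"
  assumes G: "group G" and H: "comm_group H" and iso: "dihedral H \<cong> G"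
  shows "generalised_dihedral_group G"
proof -
  interpret H: comm_group H by fact
  obtain f where f: "f \<in> iso (dihedral H) G" using iso by (auto simp: is_iso_def)
  define e where "e h = f (h, 1)" for h
  have inj: "inj_on e (carrier H)"
    using f by (auto simp: iso_def bij_betw_def inj_on_def e_def)
  have cl: "e h \<in> carrier G" if "h \<in> carrier H" for h
    using f that by (auto simp: iso_def hom_def e_def)
  have mult: "e (h \<otimes>\<^bsub>H\<^esub> h') = e h \<otimes>\<^bsub>G\<^esub> e h'"
    if "h \<in> carrier H" "h' \<in> carrier H" for h h'
  proof -
    have "f ((h, 1) \<otimes>\<^bsub>dihedral H\<^esub> (h', 1)) = f (h, 1) \<otimes>\<^bsub>G\<^esub> f (h', 1)"
      using f that by (intro hom_mult[of f "dihedral H" G]) (auto simp: iso_def)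
    then show ?thesis by (simp add: e_def)
  qed
  define H' :: "'a monoid" where
    "H' = \<lparr> carrier = e ` carrier H, mult = (\<otimes>\<^bsub>G\<^esub>), one = e \<one>\<^bsub>H\<^esub> \<rparr>"
  have H'_simps: "carrier H' = e ` carrier H" "(\<otimes>\<^bsub>H'\<^esub>) = (\<otimes>\<^bsub>G\<^esub>)" "\<one>\<^bsub>H'\<^esub> = e \<one>\<^bsub>H\<^esub>"
    by (simp_all add: H'_def)
  have H': "comm_group H'"
  proof (rule comm_groupI)
    fix x assume "x \<in> carrier H'"
    then obtain h where h: "h \<in> carrier H" "x = e h" by (auto simp: H'_simps)
    then have "e (inv\<^bsub>H\<^esub> h) \<otimes>\<^bsub>H'\<^esub> x = \<one>\<^bsub>H'\<^esub>" by (simp add: H'_simps flip: mult)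
    then show "\<exists>y\<in>carrier H'. y \<otimes>\<^bsub>H'\<^esub> x = \<one>\<^bsub>H'\<^esub>" using h by (auto simp: H'_simps)
  qed (auto simp: H'_simps H.m_ac simp flip: mult)
  then interpret H': comm_group H' .
  have e: "e \<in> hom H H'" by (auto simp: hom_def H'_simps mult)
  have e_inv: "e (inv\<^bsub>H\<^esub> h) = inv\<^bsub>H'\<^esub> e h" if "h \<in> carrier H" for h
    using group_hom.hom_inv[of H H' e h] e that H.is_group H'.is_group
    by (simp add: group_hom_def group_hom_axioms_def)
  have "map_prod e id \<in> iso (dihedral H) (dihedral H')"
    using inj by (auto simp: iso_def hom_def bij_betw_def inj_on_def H'_simps mult e_inv image_iff)
  then have "dihedral H \<cong> dihedral H'" by (rule is_isoI)
  then have "dihedral H' \<cong> dihedral H" using dihedral_group[OF H] by (simp add: group.iso_sym)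
  then have "dihedral H' \<cong> G" using iso by (rule iso_trans)
  with G H' show ?thesis unfolding generalised_dihedral_group_def by blast
qed

lemma cayley_graph_pair_graph:
  assumes "group G" "finite (carrier G)" "\<And>s. s \<in> S \<Longrightarrow> inv\<^bsub>G\<^esub> s \<in> S" "\<one>\<^bsub>G\<^esub> \<notin> S"
  shows "pair_graph (cayley_graph G S)"
proof -
  interpret group G by fact
  have "parcs (cayley_graph G S) \<subseteq> carrier G \<times> carrier G" by (auto simp: cayley_graph_def)
  then have fin: "finite (parcs (cayley_graph G S))" using assms(2) finite_subset by blast
  have "sym (parcs (cayley_graph G S))"
  proof (rule symI)
    fix g h assume "(g, h) \<in> parcs (cayley_graph G S)"
    then have gh: "g \<in> carrier G" "h \<in> carrier G" "g \<otimes>\<^bsub>G\<^esub> inv\<^bsub>G\<^esub> h \<in> S"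
      by (auto simp: cayley_graph_def)
    then have "inv\<^bsub>G\<^esub> (g \<otimes>\<^bsub>G\<^esub> inv\<^bsub>G\<^esub> h) \<in> S" using assms(3) by blast
    then show "(h, g) \<in> parcs (cayley_graph G S)"
      using gh by (simp add: cayley_graph_def inv_mult_group)
  qed
  then show ?thesis
    using fin assms by unfold_locales (auto simp: cayley_graph_def symmetric_def arcs_ends_conv)
qed

lemma cayley_graph_out_degree:
  assumes "group G" "S \<subseteq> carrier G" "\<And>s. s \<in> S \<Longrightarrow> inv\<^bsub>G\<^esub> s \<in> S" "g \<in> carrier G"
  shows "out_degree (with_proj (cayley_graph G S)) g = card S"
proof -
  interpret group G by fact
  have "bij_betw (\<lambda>s. (g, inv\<^bsub>G\<^esub> s \<otimes>\<^bsub>G\<^esub> g)) S (out_arcs (with_proj (cayley_graph G S)) g)"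
  proof (rule bij_betwI)
    show "(\<lambda>s. (g, inv\<^bsub>G\<^esub> s \<otimes>\<^bsub>G\<^esub> g)) \<in> S \<rightarrow> out_arcs (with_proj (cayley_graph G S)) g"
      using assms by (auto simp: out_arcs_def cayley_graph_def inv_mult_group subset_iff simp flip: m_assoc)
    show "(\<lambda>(x, y). x \<otimes>\<^bsub>G\<^esub> inv\<^bsub>G\<^esub> y) \<in> out_arcs (with_proj (cayley_graph G S)) g \<rightarrow> S"
      by (auto simp: out_arcs_def cayley_graph_def)
  next
    fix s assume "s \<in> S"
    then show "(\<lambda>(x, y). x \<otimes>\<^bsub>G\<^esub> inv\<^bsub>G\<^esub> y) (g, inv\<^bsub>G\<^esub> s \<otimes>\<^bsub>G\<^esub> g) = s"
      using assms by (auto simp: inv_mult_group subset_iff simp flip: m_assoc)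
  next
    fix a assume "a \<in> out_arcs (with_proj (cayley_graph G S)) g"
    then show "(g, inv\<^bsub>G\<^esub> (case a of (x, y) \<Rightarrow> x \<otimes>\<^bsub>G\<^esub> inv\<^bsub>G\<^esub> y) \<otimes>\<^bsub>G\<^esub> g) = a"
      by (auto simp: out_arcs_def cayley_graph_def inv_mult_group m_assoc)
  qed
  then show ?thesis unfolding out_degree_def by (simp add: bij_betw_same_card)
qed

end

theory Submission
  imports Defs
begin

text \<open>
  Call the elements \<open>(h, 1)\<close> of the dihedral group of \<open>H\<close> rotations and the elements \<open>(h, -1)\<close>
  reflections; there are \<open>n\<close> of each. Let the connection set consist of \<open>a\<close> rotations and \<open>b\<close>
  reflections. Diameter at most 2 means that each group element is the identity, a generator or a
  product of two generators. For a reflection the identity is excluded, and in a product exactly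
  one of the two factors is a reflection. The naive count of such products would be \<open>2 * a * b\<close>,
  but inversion by a reflection makes half of them redundant: a reflection \<open>s\<close> and a rotation
  \<open>r\<close> satisfy \<open>s r = r\<^sup>-\<^sup>1 s\<close>, and \<open>r\<^sup>-\<^sup>1\<close> is again a generator.
  So every reflection is a reflecting generator multiplied on the left by the identity or by a
  rotating generator, which gives \<open>n \<le> (a + 1) * b\<close>. The two factors on the right have the
  sum \<open>d + 1\<close>, and the inequality of arithmetic and geometric means yields
  \<open>4 * n \<le> (d + 1)\<^sup>2\<close>.

  The counting is carried out in \<open>dihedral H\<close> itself (\<open>dihedral_two_step_bound\<close>); the
  passage from the metric hypothesis to products of generators is
  \<open>cayley_diameter_two_product\<close>.
\<close>

text \<open>
  The distance is an infimum of extended reals, so a bound on it need not a priori be met by a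
  walk. With unit weights the costs are natural numbers, and a walk of cost below
  \<open>k + 1\<close> has length at most \<open>k\<close>.
\<close>
lemma (in wf_digraph) short_walk:
  assumes "\<mu> (\<lambda>_. 1) u v \<le> ereal (real k)"
  obtains p where "awalk u p v" "length p \<le> k"
proof -
  have "\<mu> (\<lambda>_. 1) u v < ereal (real (Suc k))"
    by (rule order_le_less_trans[OF assms]) simp
  then obtain p where p: "awalk u p v" and "ereal (awalk_cost (\<lambda>_. 1) p) < ereal (real (Suc k))"
    unfolding \<mu>_def by (auto simp: INF_less_iff)
  moreover have "awalk_cost (\<lambda>_. 1) p = real (length p)"
    by (simp add: awalk_cost_def sum_list_triv)
  ultimately show thesis using that by auto
qed

lemma cayley_graph_wf_digraph: "wf_digraph (with_proj (cayley_graph G S))"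
  by unfold_locales (auto simp: cayley_graph_def)

text \<open>
  An arc from \<open>g\<close> to \<open>h\<close> means that \<open>g = s h\<close> for some \<open>s\<close> in \<open>S\<close>. Hence a walk from \<open>g\<close> to the
  identity spells \<open>g\<close> as the product of the generators along its arcs.
\<close>
lemma cayley_diameter_two_product:
  assumes "group G"
    and diam: "graph_diameter (with_proj (cayley_graph G S)) \<le> 2"
    and g: "g \<in> carrier G"
  shows "g = \<one>\<^bsub>G\<^esub> \<or> g \<in> S \<or> (\<exists>s\<in>S. \<exists>t\<in>S. g = s \<otimes>\<^bsub>G\<^esub> t)"
proof -
  interpret group G by fact
  let ?X = "with_proj (cayley_graph G S)"
  interpret X: wf_digraph ?X by (rule cayley_graph_wf_digraph)
  have verts: "verts ?X = carrier G" by (simp add: cayley_graph_def)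
  have "X.\<mu> (\<lambda>_. 1) g \<one>\<^bsub>G\<^esub> \<le> graph_diameter ?X"
    unfolding graph_diameter_def using g
    by (intro SUP_upper2[of g] SUP_upper2[of "\<one>\<^bsub>G\<^esub>"]) (auto simp: verts simp del: with_proj_simps)
  with diam have "X.\<mu> (\<lambda>_. 1) g \<one>\<^bsub>G\<^esub> \<le> ereal (real 2)" by simp
  then obtain p where p: "X.awalk g p \<one>\<^bsub>G\<^esub>" and len: "length p \<le> 2"
    by (rule X.short_walk)
  have arc_iff: "(x, y) \<in> parcs (cayley_graph G S) \<longleftrightarrow>
      x \<in> carrier G \<and> y \<in> carrier G \<and> x \<otimes>\<^bsub>G\<^esub> inv\<^bsub>G\<^esub> y \<in> S" for x y
    by (simp add: cayley_graph_def)
  consider "p = []" | e where "p = [e]" | e e' where "p = [e, e']"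
    using len by (cases p rule: remdups_adj.cases) auto
  then show ?thesis
  proof cases
    case 1
    then show ?thesis using p by (simp add: X.awalk_simps)
  next
    case (2 e)
    then have "(g, \<one>\<^bsub>G\<^esub>) \<in> parcs (cayley_graph G S)"
      using p by (cases e) (auto simp: X.awalk_simps)
    then show ?thesis using g by (simp add: arc_iff)
  next
    case (3 e e')
    then have "(g, snd e) \<in> parcs (cayley_graph G S)" "(snd e, \<one>\<^bsub>G\<^esub>) \<in> parcs (cayley_graph G S)"
      using p by (cases e; cases e'; auto simp: X.awalk_simps)+
    then obtain x where "x \<in> carrier G" "g \<otimes>\<^bsub>G\<^esub> inv\<^bsub>G\<^esub> x \<in> S" "x \<in> S"
      by (auto simp: arc_iff)
    moreover from this have "g = (g \<otimes>\<^bsub>G\<^esub> inv\<^bsub>G\<^esub> x) \<otimes>\<^bsub>G\<^esub> x" using g by (simp add: m_assoc)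
    ultimately show ?thesis by blast
  qed
qed

lemma dihedral_inv_rotation:
  assumes "comm_group H" "h \<in> carrier H"
  shows "inv\<^bsub>dihedral H\<^esub> (h, 1) = (inv\<^bsub>H\<^esub> h, 1)"
proof -
  interpret comm_group H by fact
  show ?thesis
    by (rule group.inv_equality[OF dihedral_group[OF assms(1)]]) (use assms(2) in auto)
qed

text \<open>
  Only the reflections are counted. Since the set \<open>A\<close> of rotating generators is closed under
  inversion, both kinds of mixed products lie in the single product set of \<open>A\<close> and the set \<open>B\<close>
  of reflecting generators; adjoining the identity to \<open>A\<close> accounts for the reflections that are
  themselves generators.
\<close>
lemma dihedral_two_step_bound:
  fixes H :: "('h, 'm) monoid_scheme"
  assumes H: "comm_group H" and fin: "finite (carrier H)"
    and T: "T \<subseteq> carrier (dihedral H)"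
    and T_inv: "\<And>t. t \<in> T \<Longrightarrow> inv\<^bsub>dihedral H\<^esub> t \<in> T"
    and cover: "\<And>x. x \<in> carrier (dihedral H) \<Longrightarrow>
      x = \<one>\<^bsub>dihedral H\<^esub> \<or> x \<in> T \<or> (\<exists>s\<in>T. \<exists>t\<in>T. x = s \<otimes>\<^bsub>dihedral H\<^esub> t)"
  shows "4 * order H \<le> (card T + 1)\<^sup>2"
proof -
  interpret comm_group H by fact
  define A where "A = {h. (h, 1) \<in> T}"
  define B where "B = {h. (h, -1) \<in> T}"
  have sub: "A \<subseteq> carrier H" "B \<subseteq> carrier H" using T by (auto simp: A_def B_def)
  then have fin': "finite A" "finite B" using fin finite_subset by blast+
  have A_inv: "inv\<^bsub>H\<^esub> a \<in> A" if "a \<in> A" for a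
    using that T_inv[of "(a, 1)"] dihedral_inv_rotation[OF H, of a] sub by (auto simp: A_def)
  have "T = A \<times> {1} \<union> B \<times> {-1}" using T by (auto simp: A_def B_def)
  moreover have "card (A \<times> {1::int} \<union> B \<times> {-1}) = card A + card B"
    using fin' by (subst card_Un_disjoint) auto
  ultimately have card_T: "card T = card A + card B" by simp
  have "carrier H \<subseteq> (\<lambda>(a, b). a \<otimes>\<^bsub>H\<^esub> b) ` (insert \<one>\<^bsub>H\<^esub> A \<times> B)"
  proof
    fix h assume h: "h \<in> carrier H"
    have "\<exists>a\<in>insert \<one>\<^bsub>H\<^esub> A. \<exists>b\<in>B. h = a \<otimes>\<^bsub>H\<^esub> b"
    proof (cases "h \<in> B")
      case True
      then show ?thesis using h by force
    next
      case False
      then obtain x k y l where xy: "(x, k) \<in> T" "(y, l) \<in> T"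
        and prod: "(h, -1) = (x, k) \<otimes>\<^bsub>dihedral H\<^esub> (y, l)"
        using cover[of "(h, -1)"] h by (auto simp: B_def)
      have carr: "x \<in> carrier H" "y \<in> carrier H" and kl: "k \<in> {-1, 1}" "l \<in> {-1, 1}"
        using T xy by auto
      \<comment> \<open>The second components multiply to \<open>-1\<close>, so exactly one factor is a reflection.\<close>
      then consider "k = 1" "l = -1" | "k = -1" "l = 1" using prod by auto
      then show ?thesis
      proof cases
        case 1
        then show ?thesis using xy prod by (auto simp: A_def B_def)
      next
        case 2
        \<comment> \<open>Moving the rotation to the left past the reflection inverts it.\<close>
        then have "inv\<^bsub>H\<^esub> y \<in> A" "x \<in> B" using xy A_inv by (auto simp: A_def B_def)
        moreover have "h = inv\<^bsub>H\<^esub> y \<otimes>\<^bsub>H\<^esub> x" using 2 prod carr by (simp add: m_comm)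
        ultimately show ?thesis by blast
      qed
    qed
    then show "h \<in> (\<lambda>(a, b). a \<otimes>\<^bsub>H\<^esub> b) ` (insert \<one>\<^bsub>H\<^esub> A \<times> B)" by force
  qed
  then have "order H \<le> card (insert \<one>\<^bsub>H\<^esub> A \<times> B)"
    unfolding order_def using fin' by (intro surj_card_le) auto
  also have "\<dots> \<le> (card A + 1) * card B"
    using fin' by (auto simp: card_cartesian_product card_insert_if)
  finally have "4 * order H \<le> 4 * ((card A + 1) * card B)" by simp
  also have "\<dots> \<le> (card A + 1 + card B)\<^sup>2"
  proof -
    have "4 * (x * y) \<le> (x + y)\<^sup>2" for x y :: nat
    proof -
      have "4 * (int x * int y) \<le> (int x + int y)\<^sup>2"
        using zero_le_power2[of "int x - int y"] by (simp add: power2_eq_square algebra_simps)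
      then have "int (4 * (x * y)) \<le> int ((x + y)\<^sup>2)" by simp
      then show ?thesis by (simp only: of_nat_le_iff)
    qed
    then show ?thesis .
  qed
  finally show ?thesis by (simp add: card_T add_ac)
qed

theorem lemma2:
  fixes G :: "('a, 'b) monoid_scheme" and S :: "'a set" and n :: nat
  assumes "generalised_dihedral_group G"
    and "finite (carrier G)"
    and "order G = 2 * n"
    and "S \<subseteq> carrier G"
    and "\<And>s. s \<in> S \<Longrightarrow> inv\<^bsub>G\<^esub> s \<in> S"
    and "\<one>\<^bsub>G\<^esub> \<notin> S"
    and "generate G S = carrier G"
    and "graph_diameter (with_proj (cayley_graph G S)) = 2"
  shows "real (card S) \<ge> 2 * sqrt (real n) - 1"
proof -
  obtain H :: "'a monoid" and f where G: "group G" and H: "comm_group H"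
    and f: "f \<in> iso (dihedral H) G"
    using assms(1) by (auto simp: generalised_dihedral_group_def is_iso_def)
  let ?D = "dihedral H"
  have D: "group ?D" by (rule dihedral_group[OF H])
  interpret f: group_hom ?D G f
    using f D G by (simp add: group_hom_def group_hom_axioms_def iso_def)
  have bij: "bij_betw f (carrier ?D) (carrier G)" using f by (simp add: iso_def)
  then have inj: "inj_on f (carrier ?D)" and surj: "f ` carrier ?D = carrier G"
    by (auto simp: bij_betw_def)
  have "finite (carrier ?D)" using bij assms(2) by (simp add: bij_betw_finite)
  then have fin: "finite (carrier H)" by (auto dest: finite_cartesian_productD1)
  have "order G = card (carrier ?D)" using bij by (simp add: order_def bij_betw_same_card)
  also have "\<dots> = 2 * order H" by (simp add: order_def card_cartesian_product)
  finally have n: "order H = n" using assms(3) by simp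
  define T where "T = {x \<in> carrier ?D. f x \<in> S}"
  have "f ` T = S" using surj assms(4) by (auto simp: T_def)
  moreover have "inj_on f T" using inj by (rule inj_on_subset) (auto simp: T_def)
  ultimately have card_T: "card T = card S" using card_image[of f T] by simp
  have "4 * order H \<le> (card T + 1)\<^sup>2"
  proof (rule dihedral_two_step_bound[OF H fin])
    show "T \<subseteq> carrier ?D" by (auto simp: T_def)
    show "inv\<^bsub>?D\<^esub> t \<in> T" if "t \<in> T" for t
      using that assms(5) by (auto simp del: dihedral_simps simp: T_def)
    show "x = \<one>\<^bsub>?D\<^esub> \<or> x \<in> T \<or> (\<exists>s\<in>T. \<exists>t\<in>T. x = s \<otimes>\<^bsub>?D\<^esub> t)" if x: "x \<in> carrier ?D" for x
    proof -
      have "f x \<in> carrier G" using x by (rule f.hom_closed)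
      with assms(8) consider "f x = \<one>\<^bsub>G\<^esub>" | "f x \<in> S"
        | s t where "s \<in> S" "t \<in> S" "f x = s \<otimes>\<^bsub>G\<^esub> t"
        using cayley_diameter_two_product[OF G, of S "f x"] by auto
      then show ?thesis
      proof cases
        case 1
        then have "f x = f \<one>\<^bsub>?D\<^esub>" by (simp only: f.hom_one)
        then show ?thesis using inj x f.G.one_closed by (blast dest: inj_onD)
      next
        case 2
        then show ?thesis using x by (simp add: T_def)
      next
        case (3 s t)
        with \<open>f ` T = S\<close> obtain y z where yz: "y \<in> T" "z \<in> T" "s = f y" "t = f z" by blast
        then have "y \<in> carrier ?D" "z \<in> carrier ?D" by (auto simp: T_def)
        then have "x = y \<otimes>\<^bsub>?D\<^esub> z"
          using inj_onD[OF inj _ x, of "y \<otimes>\<^bsub>?D\<^esub> z"] 3 yz f.hom_mult f.G.m_closed by metis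
        with yz show ?thesis by blast
      qed
    qed
  qed
  then have "4 * n \<le> (card S + 1)\<^sup>2" by (simp add: n card_T)
  then have "real (4 * n) \<le> real ((card S + 1)\<^sup>2)" by (simp only: of_nat_le_iff)
  then have "sqrt (4 * real n) \<le> real (card S) + 1" by (intro real_le_lsqrt) (auto simp: add_ac)
  then show ?thesis by (simp add: real_sqrt_mult)
qed

end
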